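(* $m_g(2,2)=7$.
   Context: For a prime power $q$, $\mathbb{P}^2(\mathbb{F}_q)$ is the projective plane over the field $\mathbb{F}_q$ with $q$ elements. A conic is the zero set in $\mathbb{P}^2(\mathbb{F}_q)$ of a nonzero homogeneous quadratic form over $\mathbb{F}_q$; it may be reducible (e.g. a union of two lines). A generalized $k$-arc is a set of $k$ points of $\mathbb{P}^2(\mathbb{F}_q)$ such that no six of them lie on a (possibly reducible) conic. It is complete if it is not contained in a generalized $(k+1)$-arc. $m_g(2,q)$ is the size of the largest complete generalized $k$-arc in $\mathbb{P}^2(\mathbb{F}_q)$. *)

theory Defs
  imports "HOL-Analysis.Cartesian_Space"
begin

definition projective_plane :: "('a::field ^ 3) set set" where
  "projective_plane = {P. vec.subspace P \<and> vec.dim P = 1}"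

text \<open>
  A ternary quadratic form is given by the coefficients of its six monomials, so that being
  nonzero is a condition on the polynomial and not on the function it induces.
\<close>

definition quadratic_form ::
    "'a::field \<times> 'a \<times> 'a \<times> 'a \<times> 'a \<times> 'a \<Rightarrow> 'a ^ 3 \<Rightarrow> 'a" where
  "quadratic_form = (\<lambda>(a, b, c, d, e, f) v.
     a * (v $ 1)\<^sup>2 + b * (v $ 2)\<^sup>2 + c * (v $ 3)\<^sup>2
     + d * (v $ 1) * (v $ 2) + e * (v $ 1) * (v $ 3) + f * (v $ 2) * (v $ 3))"

definition conic :: "('a::field ^ 3) set set \<Rightarrow> bool" where
  "conic C \<longleftrightarrow> (\<exists>q. q \<noteq> (0, 0, 0, 0, 0, 0) \<and>
     C = {P \<in> projective_plane. \<forall>v \<in> P. quadratic_form q v = 0})"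

definition generalized_arc :: "nat \<Rightarrow> ('a::field ^ 3) set set \<Rightarrow> bool" where
  "generalized_arc k S \<longleftrightarrow> S \<subseteq> projective_plane \<and> finite S \<and> card S = k \<and>
     \<not> (\<exists>T C. T \<subseteq> S \<and> card T = 6 \<and> conic C \<and> T \<subseteq> C)"

definition complete_generalized_arc :: "nat \<Rightarrow> ('a::field ^ 3) set set \<Rightarrow> bool" where
  "complete_generalized_arc k S \<longleftrightarrow> generalized_arc k S \<and>
     \<not> (\<exists>S'. generalized_arc (k + 1) S' \<and> S \<subseteq> S')"

text \<open>
  The field with \<open>q\<close> elements is unique up to isomorphism; it enters through a type argument.
  The maximum is over a finite nonempty set because the plane has finitely many points.
\<close>

definition m_g :: "'a::{field, finite} itself \<Rightarrow> nat" where
  "m_g _ = Max {k. \<exists>S :: ('a ^ 3) set set. complete_generalized_arc k S}"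

end

theory Submission
  imports Defs
begin

text \<open>
  The plane over the field with two elements has only seven points, so the claim is that all seven
  of them together form a generalized arc: no nonzero quadratic form vanishes at six points. The
  reason is a parity obstruction. A quadratic form has degree two, which is less than the number of
  variables, so its values at the eight vectors add up to zero, as in the Chevalley--Warning
  theorem (\<open>sum_quadratic_form_eq_0\<close>). A form that vanishes at six points, hence at every vector
  except perhaps one, therefore vanishes at that vector too. A form that vanishes everywhere has
  only zero coefficients (\<open>quadratic_form_coefficients_eq_0\<close>): no monomial of a quadratic form
  collapses onto another one under \<open>x\<^sup>2 = x\<close>.
\<close>

lemma UNIV_field_card_2:
  assumes "CARD('a::{field, finite}) = 2"
  shows "(UNIV :: 'a set) = {0, 1}"
  using assms by (intro card_subset_eq[symmetric]) auto

lemma one_plus_one_field_card_2: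
  assumes "CARD('a::{field, finite}) = 2"
  shows "(1::'a) + 1 = 0"
proof -
  have "(1::'a) + 1 \<in> {0, 1}"
    using UNIV_field_card_2[OF assms] by blast
  moreover have "(1::'a) + 1 \<noteq> 1"
    using add_left_cancel[of 1 1 "0::'a"] by (metis add_0_right zero_neq_one)
  ultimately show ?thesis
    by blast
qed

lemma bij_vector_3: "bij (\<lambda>(x, y, z). vector [x, y, z] :: 'a::zero ^ 3)"
  by (rule bij_betw_byWitness[where f' = "\<lambda>v. (v $ 1, v $ 2, v $ 3)"])
    (auto simp: vec_eq_iff forall_3)

text \<open>
  Each monomial leaves out at least one of the three variables, and summing over that variable
  multiplies its contribution by two, which is zero.
\<close>

lemma sum_quadratic_form_eq_0:
  fixes q :: "'a::{field, finite} \<times> 'a \<times> 'a \<times> 'a \<times> 'a \<times> 'a"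
  assumes "CARD('a) = 2"
  shows "(\<Sum>v\<in>UNIV. quadratic_form q v) = 0"
proof -
  have two: "x + x = 0" for x :: 'a
    using one_plus_one_field_card_2[OF assms] distrib_left[of x 1 1] by (simp del: one_add_one)
  obtain a b c d e f where q: "q = (a, b, c, d, e, f)"
    by (cases q)
  have "(\<Sum>v\<in>UNIV. quadratic_form q v)
      = (\<Sum>(x, y, z)\<in>UNIV. quadratic_form q (vector [x, y, z]))"
    by (subst sum.reindex_bij_betw[OF bij_vector_3, symmetric]) (simp add: case_prod_unfold)
  also have "\<dots> = (\<Sum>x\<in>UNIV. \<Sum>y\<in>UNIV. \<Sum>z\<in>UNIV. quadratic_form q (vector [x, y, z]))"
    by (simp add: sum.cartesian_product UNIV_Times_UNIV[symmetric] del: UNIV_Times_UNIV)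
  also have "\<dots> = (a + a + (b + b) + (c + c) + d + e + f) + (a + a + (b + b) + (c + c) + d + e + f)"
    by (simp add: UNIV_field_card_2[OF assms] quadratic_form_def q algebra_simps)
  also have "\<dots> = 0"
    by (rule two)
  finally show ?thesis .
qed

text \<open>
  The unit vectors detect the coefficients of the squares, and their pairwise sums then detect the
  coefficients of the mixed products.
\<close>

lemma quadratic_form_coefficients_eq_0:
  assumes "\<And>v :: 'a::field ^ 3. quadratic_form q v = 0"
  shows "q = (0, 0, 0, 0, 0, 0)"
proof -
  obtain a b c d e f where q: "q = (a, b, c, d, e, f)"
    by (cases q)
  show ?thesis
    using assms[of "vector [1, 0, 0]"] assms[of "vector [0, 1, 0]"] assms[of "vector [0, 0, 1]"]
      assms[of "vector [1, 1, 0]"] assms[of "vector [1, 0, 1]"] assms[of "vector [0, 1, 1]"]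
    by (simp add: quadratic_form_def q)
qed

lemma quadratic_form_zero_off_one_vector:
  fixes w :: "'a::{field, finite} ^ 3"
  assumes "CARD('a) = 2"
    and off: "\<And>v. v \<noteq> w \<Longrightarrow> quadratic_form q v = 0"
  shows "q = (0, 0, 0, 0, 0, 0)"
proof -
  have "quadratic_form q w = (\<Sum>v\<in>UNIV. quadratic_form q v)"
    by (subst sum.mono_neutral_right[of UNIV "{w}"]) (auto simp: off)
  also have "\<dots> = 0"
    by (rule sum_quadratic_form_eq_0[OF assms(1)])
  finally show ?thesis
    using off by (intro quadratic_form_coefficients_eq_0) metis
qed

text \<open>The only nonzero scalar is one, so a point of the plane is the same as a nonzero vector.\<close>

lemma projective_plane_card_2:
  assumes "CARD('a::{field, finite}) = 2"
  shows "(projective_plane :: ('a ^ 3) set set) = (\<lambda>v. {0, v}) ` (UNIV - {0})"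
proof -
  have line: "vec.span {v} = {0, v}" for v :: "'a ^ 3"
    by (auto simp: vec.span_singleton UNIV_field_card_2[OF assms])
  show ?thesis
  proof (intro equalityI subsetI)
    fix P :: "('a ^ 3) set"
    assume "P \<in> projective_plane"
    then have P: "vec.subspace P" "vec.dim P = 1"
      by (auto simp: projective_plane_def)
    obtain B where B: "B \<subseteq> P" "vec.independent B" "P \<subseteq> vec.span B" "card B = 1"
      using vec.basis_exists[of P] P(2) by metis
    then obtain v where v: "B = {v}"
      by (auto simp: card_1_singleton_iff)
    have "P = vec.span {v}"
      using B v P(1) by (metis vec.span_minimal equalityI)
    moreover have "v \<noteq> 0"
      using B(2) v vec.dependent_zero by blast
    ultimately show "P \<in> (\<lambda>v. {0, v}) ` (UNIV - {0})"
      using line by auto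
  next
    fix P :: "('a ^ 3) set"
    assume "P \<in> (\<lambda>v. {0, v}) ` (UNIV - {0})"
    then obtain v where v: "v \<noteq> 0" "P = vec.span {v}"
      using line by auto
    have "vec.dim P = card {v}"
      using v by (metis vec.dim_span_eq_card_independent vec.independent_insert vec.independent_empty
          vec.span_empty singletonD)
    then show "P \<in> projective_plane"
      using v by (simp add: projective_plane_def)
  qed
qed

lemma card_projective_plane_card_2:
  assumes "CARD('a::{field, finite}) = 2"
  shows "card (projective_plane :: ('a ^ 3) set set) = 7"
proof -
  have "inj_on (\<lambda>v :: 'a ^ 3. {0, v}) (UNIV - {0})"
    by (auto simp: inj_on_def doubleton_eq_iff)
  moreover have "CARD('a ^ 3) = 8"
    by (simp add: assms)
  ultimately show ?thesis
    by (simp add: projective_plane_card_2[OF assms] card_image)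
qed


lemma no_conic_through_six_points:
  fixes T C :: "('a::{field, finite} ^ 3) set set"
  assumes card2: "CARD('a) = 2"
    and T: "T \<subseteq> projective_plane" "card T = 6"
    and C: "conic C" "T \<subseteq> C"
  shows False
proof -
  obtain q where q: "q \<noteq> (0, 0, 0, 0, 0, 0)"
    and zero: "\<And>P v. P \<in> T \<Longrightarrow> v \<in> P \<Longrightarrow> quadratic_form q v = 0"
    using C unfolding conic_def by blast
  have "card (projective_plane - T) = 1"
    by (subst card_Diff_subset) (use T card_projective_plane_card_2[OF card2] in auto)
  then obtain P where P: "projective_plane - T = {P}"
    by (auto simp: card_1_singleton_iff)
  then obtain w where w: "P = {0, w}"
    using projective_plane_card_2[OF card2] by blast
  have "quadratic_form q v = 0" if "v \<noteq> w" for v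
  proof (cases "v = 0")
    case True
    then show ?thesis by (cases q) (simp add: quadratic_form_def)
  next
    case False
    then have "{0, v} \<in> projective_plane"
      using projective_plane_card_2[OF card2] by blast
    moreover have "{0, v} \<noteq> P"
      using w False that by (auto simp: doubleton_eq_iff)
    ultimately have "{0, v} \<in> T"
      using P by (metis DiffI singletonD)
    then show ?thesis
      by (rule zero) simp
  qed
  then show False
    using quadratic_form_zero_off_one_vector[OF card2] q by blast
qed

theorem proposition2:
  assumes "CARD('a::{field, finite}) = 2"
  shows "m_g TYPE('a) = 7"
proof -
  let ?plane = "projective_plane :: ('a ^ 3) set set"
  have bound: "k \<le> 7" if "generalized_arc k S" for k and S :: "('a ^ 3) set set"
    using that card_mono[of ?plane S] card_projective_plane_card_2[OF assms]
    by (auto simp: generalized_arc_def)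
  have "generalized_arc 7 ?plane"
    using no_conic_through_six_points[OF assms] card_projective_plane_card_2[OF assms]
    by (auto simp: generalized_arc_def)
  then have "complete_generalized_arc 7 ?plane"
    using bound[of 8] by (auto simp: complete_generalized_arc_def)
  moreover have bounded: "k \<le> 7" if "complete_generalized_arc k S"
    for k and S :: "('a ^ 3) set set"
    using that bound unfolding complete_generalized_arc_def by blast
  moreover have "finite {k. \<exists>S :: ('a ^ 3) set set. complete_generalized_arc k S}"
    by (rule finite_subset[of _ "{..7}"]) (use bounded in auto)
  ultimately show ?thesis
    unfolding m_g_def by (intro Max_eqI) blast+
qed

end
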